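(* Let $\square\subset\mathbb R^2$ be a $0$-symmetric convex body. Then $$1\le\lambda_1(\mathbb Z^2,\square)\cdot\lambda_2(\check{\mathbb Z}^2,\square^* )\le\frac32.$$
   Context: A convex body is a compact convex set with nonempty interior; $0$-symmetric means $\square=-\square$. $\check{\mathbb Z}^2=\mathrm{Hom}_{\mathbb Z}(\mathbb Z^2,\mathbb Z)$ is the dual lattice and $\square^*=\{\varphi\in\check{\mathbb R}^2:\langle\varphi,m\rangle\ge-1\ \forall m\in\square\}$ is the polar body in the dual space $\check{\mathbb R}^2=\check{\mathbb Z}^2\otimes\mathbb R$. For a lattice $\Lambda$ of rank $d$ and a closed convex set $K\subseteq\Lambda_{\mathbb R}$ containing the origin, the $i$-th successive minimum is $\lambda_i(\Lambda,K)=\sup\{t\ge0:\dim(\Lambda\cap tK)<i\}$, where $\dim(A)$ is the dimension of the real vector space generated by $A-A$. *)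

theory Defs
  imports "HOL-Analysis.Analysis"
begin

definition convex_body :: "'a::real_normed_vector set \<Rightarrow> bool" where
  "convex_body K \<longleftrightarrow> compact K \<and> convex K \<and> interior K \<noteq> {}"

definition zero_symmetric :: "'a::real_vector set \<Rightarrow> bool" where
  "zero_symmetric K \<longleftrightarrow> K = uminus ` K"

definition int_lattice :: "(real ^ 'n) set" where
  "int_lattice = {x. \<forall>i. x $ i \<in> \<int>}"

text \<open>The dual of a finite-dimensional space is the type of (bounded) linear functionals on it.
  When \<open>L\<close> is a lattice of full rank, restricting functionals to \<open>L\<close> identifies \<open>dual_lattice L\<close>
  with the group of additive maps from \<open>L\<close> to the integers.\<close>

definition dual_lattice :: "'a::real_normed_vector set \<Rightarrow> ('a \<Rightarrow>\<^sub>L real) set" where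
  "dual_lattice L = {\<phi>. \<forall>m\<in>L. blinfun_apply \<phi> m \<in> \<int>}"

definition polar_body :: "'a::real_normed_vector set \<Rightarrow> ('a \<Rightarrow>\<^sub>L real) set" where
  "polar_body K = {\<phi>. \<forall>m\<in>K. blinfun_apply \<phi> m \<ge> -1}"

definition diff_dim :: "'a::real_vector set \<Rightarrow> nat" where
  "diff_dim A = dim (span {a - b | a b. a \<in> A \<and> b \<in> A})"

text \<open>The supremum is taken in the extended reals, since it is infinite when the lattice points
  in the dilates of \<open>K\<close> never span dimension \<open>i\<close>.\<close>

definition successive_minimum :: "nat \<Rightarrow> 'a::real_vector set \<Rightarrow> 'a set \<Rightarrow> ereal" where
  "successive_minimum i L K =
     Sup {ereal t | t. t \<ge> 0 \<and> diff_dim (L \<inter> (\<lambda>x. t *\<^sub>R x) ` K) < i}"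

end

theory Submission
  imports Defs
begin

text \<open>
  Write \<open>h f\<close> for the maximum of the functional \<open>f\<close> on \<open>K\<close>. By symmetry \<open>h f \<le> M\<close> holds exactly
  when \<open>f\<close> lies in the dilate of the polar body by \<open>M\<close>, so \<open>h\<close> is the norm that the second
  successive minimum measures, and functionals are identified with vectors by the inner product.

  The lower bound is integrality. If a nonzero lattice vector \<open>m\<close> lies in \<open>s K\<close> and lattice
  functionals in \<open>t\<close> times the polar body span the dual plane, then one of these does not vanish
  at \<open>m\<close>; its value there is a nonzero integer bounded by \<open>s t\<close> (\<open>pairing_bound\<close>).

  For the upper bound, choose a basis \<open>f, g\<close> of the dual lattice with \<open>h f + h g\<close> minimal and
  \<open>h f \<le> h g\<close>, and put \<open>M = h g\<close>. Then the second minimum is at most \<open>M\<close>. Replacing \<open>g\<close> by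
  \<open>g \<plusminus> f\<close> gives a basis again, so minimality yields \<open>h (g \<plusminus> f) \<ge> M\<close> (\<open>reduced_basis_exists\<close>).
  Hence \<open>K\<close> contains points where \<open>g = M\<close>, where \<open>g + f \<ge> M\<close> and where \<open>g - f \<ge> M\<close>. Scale \<open>K\<close> so
  that \<open>M\<close> becomes \<open>3/2\<close>, and use the dual basis \<open>u, v\<close> of the lattice as coordinates. An
  elementary planar computation shows that the symmetric hull of two of these points already
  contains one of \<open>u\<close>, \<open>v\<close>, \<open>u + v\<close>, \<open>v - u\<close>, up to sign
  (\<open>lattice_point_from_two_points\<close>). So the first minimum is at most \<open>3 / (2 M)\<close>, and the product
  of the two bounds is \<open>3/2\<close>.
\<close>

section \<open>Centrally symmetric convex sets\<close>

lemma symmetric_mem_uminus: "zero_symmetric K \<Longrightarrow> x \<in> K \<Longrightarrow> - x \<in> K"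
  unfolding zero_symmetric_def by blast

lemma symmetric_convex_combination:
  fixes K :: "'a::real_vector set"
  assumes "convex K" "zero_symmetric K" "p \<in> K" "r \<in> K" "\<bar>\<alpha>\<bar> + \<bar>\<beta>\<bar> \<le> 1"
  shows "\<alpha> *\<^sub>R p + \<beta> *\<^sub>R r \<in> K"
proof -
  have z: "0 \<in> K"
    using convexD[OF assms(1,3) symmetric_mem_uminus[OF assms(2,3)], of "1/2" "1/2"] by simp
  define p' where "p' = (if \<alpha> \<ge> 0 then p else - p)"
  define r' where "r' = (if \<beta> \<ge> 0 then r else - r)"
  have in': "p' \<in> K" "r' \<in> K"
    using assms symmetric_mem_uminus unfolding p'_def r'_def by auto
  have eq: "\<alpha> *\<^sub>R p + \<beta> *\<^sub>R r = \<bar>\<alpha>\<bar> *\<^sub>R p' + \<bar>\<beta>\<bar> *\<^sub>R r'"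
    unfolding p'_def r'_def by auto
  show ?thesis
  proof (cases "\<bar>\<alpha>\<bar> + \<bar>\<beta>\<bar> = 0")
    case True
    then have "\<alpha> = 0" "\<beta> = 0" by linarith+
    then show ?thesis using z by simp
  next
    case False
    define w where "w = \<bar>\<alpha>\<bar> + \<bar>\<beta>\<bar>"
    have w: "w > 0" "w \<le> 1" using False assms(5) unfolding w_def by linarith+
    define y where "y = (\<bar>\<alpha>\<bar> / w) *\<^sub>R p' + (\<bar>\<beta>\<bar> / w) *\<^sub>R r'"
    have "y \<in> K" unfolding y_def
      using w by (intro convexD[OF assms(1)] in')
        (auto simp: w_def simp flip: add_divide_distrib)
    then have "w *\<^sub>R y + (1 - w) *\<^sub>R 0 \<in> K"
      using w z by (intro convexD[OF assms(1)]) auto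
    moreover have "w *\<^sub>R y = \<alpha> *\<^sub>R p + \<beta> *\<^sub>R r"
      unfolding eq y_def using w by (simp add: scaleR_add_right)
    ultimately show ?thesis by simp
  qed
qed

lemma symmetric_convex_scale:
  fixes K :: "'a::real_vector set"
  assumes "convex K" "zero_symmetric K" "p \<in> K" "\<bar>\<alpha>\<bar> \<le> 1"
  shows "\<alpha> *\<^sub>R p \<in> K"
  using symmetric_convex_combination[OF assms(1-3,3), of \<alpha> 0] assms(4) by simp

section \<open>A lattice point forced by two points on the boundary lines\<close>

text \<open>
  In the coordinates given by \<open>u, v\<close>, the first point \<open>p\<close> lies on the line \<open>y = 3/2\<close> and the
  second point \<open>r\<close> on the line \<open>y - x = 3/2\<close>. The parallelogram with vertices \<open>\<plusminus>p, \<plusminus>r\<close> contains \<open>v\<close>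
  unless both points are far from the axis \<open>x = 0\<close>, that is, unless \<open>2 a e > a + e\<close>. In that case
  it is wide enough to contain \<open>u + v\<close> (when \<open>a \<ge> 1\<close>) or \<open>u\<close> (when \<open>a < 1\<close>).
\<close>

lemma lattice_point_from_two_points:
  fixes K :: "'a::real_vector set" and u v :: 'a
  assumes K: "convex K" "zero_symmetric K"
    and p: "a *\<^sub>R u + (3/2) *\<^sub>R v \<in> K" and a: "0 \<le> a" "a \<le> 3/2"
    and r: "(- e) *\<^sub>R u + (3/2 - e) *\<^sub>R v \<in> K" and e: "0 \<le> e" "e \<le> 3/2"
  shows "u \<in> K \<or> v \<in> K \<or> u + v \<in> K"
proof (cases "a = 0 \<and> e = 0")
  case True
  then show ?thesis
    using symmetric_convex_scale[OF K p, of "2/3"] by simp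
next
  case False
  define N where "N = 3*a + 3*e - 2*a*e"
  have "a * (3 - 2*e) \<ge> 0" "e * (3 - 2*a) \<ge> 0" using a e by simp_all
  moreover have "a > 0 \<or> e > 0" using False a e by linarith
  ultimately have N: "N > 0" unfolding N_def by (auto simp: algebra_simps)
  \<comment> \<open>Cramer's rule: the two given points have determinant \<open>N / 2\<close>, so lattice points have
    coefficients with denominator \<open>N\<close> with respect to them.\<close>
  have comb: "x *\<^sub>R u + y *\<^sub>R v \<in> K"
    if "\<alpha> * a - \<beta> * e = x * N" "\<alpha> * 3/2 + \<beta> * (3/2 - e) = y * N" "\<bar>\<alpha>\<bar> + \<bar>\<beta>\<bar> \<le> N"
    for \<alpha> \<beta> x y
  proof -
    have "(\<alpha>/N) *\<^sub>R (a *\<^sub>R u + (3/2) *\<^sub>R v) + (\<beta>/N) *\<^sub>R ((- e) *\<^sub>R u + (3/2 - e) *\<^sub>R v) \<in> K"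
      using that(3) N
      by (intro symmetric_convex_combination K p r) (simp add: field_simps)
    also have "(\<alpha>/N) *\<^sub>R (a *\<^sub>R u + (3/2) *\<^sub>R v) + (\<beta>/N) *\<^sub>R ((- e) *\<^sub>R u + (3/2 - e) *\<^sub>R v)
      = ((\<alpha> * a - \<beta> * e)/N) *\<^sub>R u + ((\<alpha> * 3/2 + \<beta> * (3/2 - e))/N) *\<^sub>R v"
      by (simp add: algebra_simps add_divide_distrib diff_divide_distrib)
    also have "\<dots> = x *\<^sub>R u + y *\<^sub>R v"
      using that(1,2) N by simp
    finally show ?thesis .
  qed
  show ?thesis
  proof (cases "2*a*e \<le> a + e")
    case True
    have "0 *\<^sub>R u + 1 *\<^sub>R v \<in> K"
      by (rule comb[of "2*e" "2*a"]) (use True a e in \<open>auto simp: N_def algebra_simps\<close>)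
    then show ?thesis by simp
  next
    case False
    then have big: "e * (2*a - 1) > a" by (simp add: algebra_simps)
    then have pos: "2*a - 1 > 0"
      using a e by (smt (verit) mult_nonneg_nonpos)
    show ?thesis
    proof (cases "a \<ge> 1")
      case True
      \<comment> \<open>The condition \<open>N + 2 a \<ge> 6\<close> for \<open>u + v\<close> is linear in \<open>e\<close> with nonnegative slope, so it is
        enough to have it at the smallest possible value \<open>e = a / (2 a - 1)\<close>, where it factors
        after clearing the denominator.\<close>
      have "0 \<le> 2 * ((4*a - 3) * (a - 1))" using True by simp
      also have "\<dots> = (5*a - 6) * (2*a - 1) + (3 - 2*a) * a"
        by (simp add: algebra_simps)
      also have "\<dots> \<le> (5*a - 6) * (2*a - 1) + (3 - 2*a) * (e * (2*a - 1))"
        using big a by (intro add_left_mono mult_left_mono) auto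
      also have "\<dots> = (N - 6 + 2*a) * (2*a - 1)" by (simp add: N_def algebra_simps)
      finally have "N - 6 + 2*a \<ge> 0" using pos by (simp add: zero_le_mult_iff)
      then have "1 *\<^sub>R u + 1 *\<^sub>R v \<in> K"
        by (intro comb[of 3 "2*a - 3"]) (use a e in \<open>auto simp: N_def algebra_simps\<close>)
      then show ?thesis by simp
    next
      case False
      \<comment> \<open>As before, now with the condition \<open>N + 2 e \<ge> 6\<close> for \<open>u\<close>.\<close>
      have "0 \<le> 2 * ((3 - 2*a) * (1 - a))" using False a by simp
      also have "\<dots> = (3*a - 6) * (2*a - 1) + (5 - 2*a) * a"
        by (simp add: algebra_simps)
      also have "\<dots> \<le> (3*a - 6) * (2*a - 1) + (5 - 2*a) * (e * (2*a - 1))"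
        using big a by (intro add_left_mono mult_left_mono) auto
      also have "\<dots> = (N - 6 + 2*e) * (2*a - 1)" by (simp add: N_def algebra_simps)
      finally have "N - 6 + 2*e \<ge> 0" using pos by (simp add: zero_le_mult_iff)
      then have "1 *\<^sub>R u + 0 *\<^sub>R v \<in> K"
        by (intro comb[of "3 - 2*e" "- 3"]) (use a e in \<open>auto simp: N_def field_simps\<close>)
      then show ?thesis by simp
    qed
  qed
qed

text \<open>
  Changing the signs of \<open>f\<close> and \<open>u\<close> exchanges the roles of \<open>q\<close> and \<open>r\<close>. So one may assume that \<open>f\<close>
  is nonnegative at \<open>p\<close>; scaling by \<open>3 / (2 M)\<close> then turns \<open>p\<close> and \<open>r\<close> into the two points of
  \<open>lattice_point_from_two_points\<close>.
\<close>

lemma lattice_point_from_reduced_functionals: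
  fixes K :: "'a::real_vector set" and f g :: "'a \<Rightarrow> real" and u v :: 'a
  assumes K: "convex K" "zero_symmetric K"
    and lin: "linear f" "linear g" and coords: "\<And>x. x = f x *\<^sub>R u + g x *\<^sub>R v"
    and M: "M > 0" "\<And>x. x \<in> K \<Longrightarrow> f x \<le> M" "\<And>x. x \<in> K \<Longrightarrow> g x \<le> M"
    and p: "p \<in> K" "g p = M"
    and q: "q \<in> K" "g q + f q \<ge> M"
    and r: "r \<in> K" "g r - f r \<ge> M"
  shows "\<exists>m \<in> {u, v, u + v, v - u}. m \<in> (\<lambda>x. (3 / (2 * M)) *\<^sub>R x) ` K"
proof -
  let ?c = "3 / (2 * M)"
  let ?K = "(\<lambda>x. ?c *\<^sub>R x) ` K"
  have K': "convex ?K" "zero_symmetric ?K"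
  proof -
    show "convex ?K" using K(1) by (rule convex_scaling)
    have "uminus ` ?K = (\<lambda>x. ?c *\<^sub>R x) ` uminus ` K" by (simp add: image_image)
    then show "zero_symmetric ?K" using K(2) unfolding zero_symmetric_def by simp
  qed
  have abs_f: "\<bar>f x\<bar> \<le> M" if "x \<in> K" for x
    using M(2)[OF that] M(2)[OF symmetric_mem_uminus[OF K(2) that]] lin(1)
    by (simp add: linear_neg)
  \<comment> \<open>Used for \<open>f, u, r\<close> and, when \<open>f\<close> is negative at \<open>p\<close>, for \<open>- f, - u, q\<close>.\<close>
  have main: "u' \<in> ?K \<or> v \<in> ?K \<or> u' + v \<in> ?K"
    if u': "\<And>x. x = f' x *\<^sub>R u' + g x *\<^sub>R v" and f': "\<And>x. x \<in> K \<Longrightarrow> \<bar>f' x\<bar> \<le> M"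
      and fp: "f' p \<ge> 0" and r': "r' \<in> K" "g r' - f' r' \<ge> M" for f' u' r'
  proof -
    define k where "k = g r' - f' r'"
    \<comment> \<open>Shrinking \<open>r'\<close> towards the origin moves it onto the line \<open>g - f' = M\<close>.\<close>
    define s where "s = M / k"
    have k: "k \<ge> M" "k > 0" using r' M(1) unfolding k_def by auto
    have s: "0 < s" "s \<le> 1" "s * k = M" using k M(1) by (auto simp: s_def)
    have fr: "f' r' \<le> 0" "- f' r' \<le> k"
      using r'(2) k M(3)[OF r'(1)] f'[OF r'(1)] by linarith+
    define e where "e = - (?c * s * f' r')"
    have "?c * s \<ge> 0" using s M(1) by simp
    then have e0: "0 \<le> e" using fr(1) mult_nonneg_nonpos[of "?c * s" "f' r'"] by (simp add: e_def)
    have "s * (- f' r') \<le> s * k" using fr s by (intro mult_left_mono) auto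
    then have "?c * (s * (- f' r')) \<le> ?c * M" using s M(1) by (intro mult_left_mono) auto
    then have e1: "e \<le> 3/2" using M(1) by (simp add: e_def mult.assoc)
    have "?c * (s * k) = 3/2" using s M(1) by simp
    then have eg: "?c * s * g r' = 3/2 - e" unfolding k_def e_def by (simp only: right_diff_distrib mult.assoc)
    show ?thesis
    proof (rule lattice_point_from_two_points[OF K' _ _ _ _ e0 e1])
      have "?c *\<^sub>R p = ?c *\<^sub>R (f' p *\<^sub>R u' + g p *\<^sub>R v)"
        using u'[of p] by simp
      also have "\<dots> = (?c * f' p) *\<^sub>R u' + (3/2) *\<^sub>R v"
        using p M(1) by (simp add: scaleR_add_right)
      finally show "(?c * f' p) *\<^sub>R u' + (3/2) *\<^sub>R v \<in> ?K" using p(1) by (metis image_eqI)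
      show "0 \<le> ?c * f' p" using fp M by simp
      have "?c * f' p \<le> ?c * M" using f'[OF p(1)] M(1) by (intro mult_left_mono) auto
      then show "?c * f' p \<le> 3/2" using M(1) by simp
      have "?c *\<^sub>R (s *\<^sub>R r') = ?c *\<^sub>R (s *\<^sub>R (f' r' *\<^sub>R u' + g r' *\<^sub>R v))"
        using u'[of r'] by simp
      also have "\<dots> = (?c * s * f' r') *\<^sub>R u' + (?c * s * g r') *\<^sub>R v"
        by (simp add: scaleR_add_right mult.assoc)
      also have "\<dots> = (- e) *\<^sub>R u' + (3/2 - e) *\<^sub>R v" unfolding eg by (simp add: e_def)
      finally show "(- e) *\<^sub>R u' + (3/2 - e) *\<^sub>R v \<in> ?K"
        using symmetric_convex_scale[OF K r'(1), of s] s by (metis abs_of_pos image_eqI)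
    qed
  qed
  show ?thesis
  proof (cases "f p \<ge> 0")
    case True
    then show ?thesis using main[of f u r] coords abs_f r by auto
  next
    case False
    have "- u \<in> ?K \<or> v \<in> ?K \<or> - u + v \<in> ?K"
      using main[of "\<lambda>x. - f x" "- u" q] coords abs_f q False by simp
    moreover have "- u \<in> ?K \<Longrightarrow> u \<in> ?K"
      using symmetric_mem_uminus[OF K'(2), of "- u"] by simp
    ultimately show ?thesis by auto
  qed
qed

section \<open>Reduced bases of the dual lattice\<close>

definition support_function :: "'a::real_inner set \<Rightarrow> 'a \<Rightarrow> real" where
  "support_function K f = (SUP x\<in>K. f \<bullet> x)"

lemma support_function_attained:
  fixes K :: "'a::real_inner set"
  assumes "compact K" "K \<noteq> {}"
  obtains x where "x \<in> K" "f \<bullet> x = support_function K f"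
    "\<And>y. y \<in> K \<Longrightarrow> f \<bullet> y \<le> support_function K f"
proof -
  obtain x where x: "x \<in> K" "\<forall>y\<in>K. f \<bullet> y \<le> f \<bullet> x"
    using continuous_attains_sup[OF assms, of "\<lambda>x. f \<bullet> x"] continuous_on_inner[OF continuous_on_const continuous_on_id]
    by blast
  then have "support_function K f = f \<bullet> x"
    unfolding support_function_def by (intro cSup_eq_maximum) auto
  then show ?thesis using x by (intro that[of x]) auto
qed

lemma symmetric_body_contains_ball:
  fixes K :: "'a::real_normed_vector set"
  assumes "convex_body K" "zero_symmetric K"
  obtains \<rho> where "\<rho> > 0" "cball 0 \<rho> \<subseteq> K"
proof -
  have cv: "convex K" and "interior K \<noteq> {}" using assms by (auto simp: convex_body_def)
  then obtain x \<rho> where x: "\<rho> > 0" "cball x \<rho> \<subseteq> K"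
    using mem_interior_cball by (metis all_not_in_conv)
  have "cball 0 \<rho> \<subseteq> K"
  proof
    fix y :: 'a assume "y \<in> cball 0 \<rho>"
    then have "x + y \<in> K" "x - y \<in> K" using x(2) by (auto simp: subset_iff dist_norm)
    then have "(1/2) *\<^sub>R (x + y) + (- 1/2) *\<^sub>R (x - y) \<in> K"
      by (intro symmetric_convex_combination cv assms) auto
    then show "y \<in> K" by (simp add: scaleR_add_right scaleR_diff_right flip: scaleR_add_left)
  qed
  then show ?thesis using x that by blast
qed

definition det2 :: "real ^ 2 \<Rightarrow> real ^ 2 \<Rightarrow> real" where
  "det2 f g = f $ 1 * g $ 2 - f $ 2 * g $ 1"

lemma det2_swap: "det2 g f = - det2 f g"
  by (simp add: det2_def)

lemma finite_int_lattice_norm_le: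
  "finite {f :: real ^ 2. f \<in> int_lattice \<and> norm f \<le> C}"
proof (rule finite_subset)
  let ?I = "{a :: int. \<bar>a\<bar> \<le> \<lceil>C\<rceil>}"
  show "{f :: real ^ 2. f \<in> int_lattice \<and> norm f \<le> C}
    \<subseteq> (\<lambda>(a, b). vector [of_int a, of_int b]) ` (?I \<times> ?I)"
  proof safe
    fix f :: "real ^ 2" assume f: "f \<in> int_lattice" "norm f \<le> C"
    obtain a b where ab: "f $ 1 = of_int a" "f $ 2 = of_int b"
      using f(1) unfolding int_lattice_def by (auto elim!: Ints_cases) (metis Ints_cases)
    have "\<bar>f $ 1\<bar> \<le> C" "\<bar>f $ 2\<bar> \<le> C"
      using component_le_norm_cart[of f] f(2) by (meson order_trans)+
    then have "\<bar>a\<bar> \<le> \<lceil>C\<rceil>" "\<bar>b\<bar> \<le> \<lceil>C\<rceil>"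
      unfolding ab by linarith+
    moreover have "f = vector [of_int a, of_int b]"
      by (simp add: vec_eq_iff forall_2 ab)
    ultimately show "f \<in> (\<lambda>(a, b). vector [of_int a, of_int b]) ` (?I \<times> ?I)" by auto
  qed
  have "?I = {- \<lceil>C\<rceil>..\<lceil>C\<rceil>}" by auto
  then have "finite ?I" by simp
  then show "finite ((\<lambda>(a, b). vector [of_int a, of_int b] :: real ^ 2) ` (?I \<times> ?I))"
    by simp
qed

text \<open>
  Minimizing the sum \<open>h f + h g\<close> over all bases, instead of choosing the two vectors one after the
  other, gives both inequalities for \<open>g \<plusminus> f\<close> without having to extend a primitive vector to a
  basis. A minimum exists because \<open>K\<close> contains a ball, so that only finitely many lattice vectors
  have bounded \<open>h\<close>.
\<close>

lemma reduced_basis_exists: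
  fixes K :: "(real ^ 2) set"
  assumes "convex_body K" "zero_symmetric K"
  obtains f g where "f \<in> int_lattice" "g \<in> int_lattice" "\<bar>det2 f g\<bar> = 1"
    "support_function K f \<le> support_function K g"
    "support_function K g \<le> support_function K (g + f)"
    "support_function K g \<le> support_function K (g - f)"
proof -
  let ?h = "support_function K"
  obtain \<rho> where \<rho>: "\<rho> > 0" "cball 0 \<rho> \<subseteq> K"
    using symmetric_body_contains_ball[OF assms] .
  have K: "compact K" "K \<noteq> {}" using assms \<rho> by (auto simp: convex_body_def)
  have h_ge: "\<rho> * norm f \<le> ?h f" for f :: "real ^ 2"
  proof (cases "f = 0")
    case True
    then show ?thesis using K by (simp add: support_function_def)
  next
    case False
    have "(\<rho> / norm f) *\<^sub>R f \<in> K" using \<rho> False by (auto simp: subset_iff)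
    then have "f \<bullet> ((\<rho> / norm f) *\<^sub>R f) \<le> ?h f"
      using support_function_attained[OF K] by metis
    then show ?thesis using False by (simp add: power2_norm_eq_inner[symmetric] power2_eq_square)
  qed
  define P where "P = {(f, g). f \<in> int_lattice \<and> g \<in> int_lattice \<and> \<bar>det2 f g\<bar> = 1}"
  define H where "H = (\<lambda>(f, g). ?h f + ?h g)"
  define b where "b = (axis 1 1 :: real ^ 2, axis 2 1 :: real ^ 2)"
  have b: "b \<in> P" by (auto simp: P_def b_def int_lattice_def det2_def axis_def)
  define S where "S = {x \<in> P. H x \<le> H b}"
  let ?F = "{f :: real ^ 2. f \<in> int_lattice \<and> norm f \<le> H b / \<rho>}"
  have "S \<subseteq> ?F \<times> ?F"
  proof safe
    fix f g assume "(f, g) \<in> S"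
    then have fg: "f \<in> int_lattice" "g \<in> int_lattice" "?h f + ?h g \<le> H b"
      by (auto simp: S_def P_def H_def)
    have "0 \<le> \<rho> * norm f" "0 \<le> \<rho> * norm g" using \<rho> by simp_all
    then have "\<rho> * norm f \<le> H b" "\<rho> * norm g \<le> H b"
      using fg(3) h_ge[of f] h_ge[of g] by linarith+
    then show "norm f \<le> H b / \<rho>" "norm g \<le> H b / \<rho>"
      using \<rho>(1) by (simp_all add: field_simps)
    show "f \<in> int_lattice" "g \<in> int_lattice" by fact+
  qed
  then have "finite S" using finite_int_lattice_norm_le finite_subset by blast
  moreover have "b \<in> S" using b by (simp add: S_def)
  then have "S \<noteq> {}" by blast
  ultimately obtain x where x: "x \<in> S" "\<And>y. y \<in> S \<Longrightarrow> H x \<le> H y"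
    using ex_is_arg_min_if_finite[of S H] unfolding is_arg_min_linorder by blast
  have min: "H x \<le> H y" if "y \<in> P" for y
    using x that by (cases "H y \<le> H b") (auto simp: S_def)
  obtain f0 g0 where x_eq: "x = (f0, g0)" by fastforce
  define f where "f = (if ?h f0 \<le> ?h g0 then f0 else g0)"
  define g where "g = (if ?h f0 \<le> ?h g0 then g0 else f0)"
  have fg: "(f, g) \<in> P" "H (f, g) = H x" "?h f \<le> ?h g"
    using x(1) det2_swap[of f0 g0] by (auto simp: f_def g_def x_eq S_def P_def H_def)
  have "(f, g + f) \<in> P" "(f, g - f) \<in> P"
    using fg(1) by (auto simp: P_def int_lattice_def det2_def algebra_simps)
  from min[OF this(1)] min[OF this(2)] have "?h g \<le> ?h (g + f)" "?h g \<le> ?h (g - f)"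
    using fg(2) by (auto simp: H_def)
  then show ?thesis using fg that by (auto simp: P_def)
qed

lemma dual_basis_coordinates:
  fixes f g x :: "real ^ 2"
  assumes "\<bar>det2 f g\<bar> = 1"
  defines "u \<equiv> det2 f g *\<^sub>R vector [g $ 2, - g $ 1]"
    and "v \<equiv> det2 f g *\<^sub>R vector [- f $ 2, f $ 1]"
  shows "x = (f \<bullet> x) *\<^sub>R u + (g \<bullet> x) *\<^sub>R v"
proof -
  have "det2 f g * det2 f g = 1" using assms(1) by (metis abs_mult_self_eq mult_1)
  then have "x = (det2 f g * det2 f g) *\<^sub>R x" by simp
  also have "\<dots> = (f \<bullet> x) *\<^sub>R u + (g \<bullet> x) *\<^sub>R v"
    unfolding vec_eq_iff forall_2 u_def v_def inner_vec_def sum_2 det2_def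
    by (simp add: algebra_simps)
  finally show ?thesis .
qed

text \<open>
  This is the geometric content of the upper bound: the pair \<open>f, g\<close> bounds the second minimum of
  the polar body by \<open>M\<close>, and \<open>m\<close> bounds the first minimum of \<open>K\<close> by \<open>3 / (2 M)\<close>.
\<close>

lemma reduced_pair_with_short_lattice_vector:
  fixes K :: "(real ^ 2) set"
  assumes body: "convex_body K" and sym: "zero_symmetric K"
  obtains M f g m where "M > 0"
    "f \<in> int_lattice" "g \<in> int_lattice" "det2 f g \<noteq> 0"
    "\<And>x. x \<in> K \<Longrightarrow> f \<bullet> x \<le> M" "\<And>x. x \<in> K \<Longrightarrow> g \<bullet> x \<le> M"
    "m \<in> int_lattice" "m \<noteq> 0" "m \<in> (\<lambda>x. (3 / (2 * M)) *\<^sub>R x) ` K"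
proof -
  let ?h = "support_function K"
  obtain f g where fg: "f \<in> int_lattice" "g \<in> int_lattice" "\<bar>det2 f g\<bar> = 1"
    "?h f \<le> ?h g" "?h g \<le> ?h (g + f)" "?h g \<le> ?h (g - f)"
    using reduced_basis_exists[OF assms] .
  obtain \<rho> where \<rho>: "\<rho> > 0" "cball 0 \<rho> \<subseteq> K"
    using symmetric_body_contains_ball[OF assms] .
  have K: "compact K" "K \<noteq> {}" "convex K" using body \<rho> by (auto simp: convex_body_def)
  define M where "M = ?h g"
  note att = support_function_attained[OF K(1,2)]
  have le_f: "f \<bullet> x \<le> M" and le_g: "g \<bullet> x \<le> M" if "x \<in> K" for x
    using att that fg(4) unfolding M_def by (metis order_trans)+
  obtain p where p: "p \<in> K" "g \<bullet> p = M" using att unfolding M_def by metis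
  obtain q where q: "q \<in> K" "(g + f) \<bullet> q \<ge> M" using att fg(5) unfolding M_def by metis
  obtain r where r: "r \<in> K" "(g - f) \<bullet> r \<ge> M" using att fg(6) unfolding M_def by metis
  define u :: "real ^ 2" where "u = det2 f g *\<^sub>R vector [g $ 2, - g $ 1]"
  define v :: "real ^ 2" where "v = det2 f g *\<^sub>R vector [- f $ 2, f $ 1]"
  have "g \<noteq> 0" using fg(3) by (auto simp: det2_def)
  moreover have "(\<rho> / norm g) *\<^sub>R g \<in> K" using \<rho> \<open>g \<noteq> 0\<close> by (auto simp: subset_iff)
  then have "g \<bullet> ((\<rho> / norm g) *\<^sub>R g) \<le> M" by (rule le_g)
  moreover have "g \<bullet> ((\<rho> / norm g) *\<^sub>R g) > 0" using \<rho> \<open>g \<noteq> 0\<close> by simp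
  ultimately have M: "M > 0" by linarith
  have "\<exists>m \<in> {u, v, u + v, v - u}. m \<in> (\<lambda>x. (3 / (2 * M)) *\<^sub>R x) ` K"
  proof (rule lattice_point_from_reduced_functionals[OF K(3) sym, where f = "\<lambda>x. f \<bullet> x" and g = "\<lambda>x. g \<bullet> x"])
    show "x = (f \<bullet> x) *\<^sub>R u + (g \<bullet> x) *\<^sub>R v" for x
      unfolding u_def v_def by (rule dual_basis_coordinates[OF fg(3)])
  qed (use M le_f le_g p q r in \<open>auto simp: inner_left_distrib inner_diff_left
        intro: bounded_linear.linear bounded_linear_inner_right\<close>)
  then obtain m where m: "m \<in> {u, v, u + v, v - u}" "m \<in> (\<lambda>x. (3 / (2 * M)) *\<^sub>R x) ` K" by blast
  have "det2 f g \<in> \<int>" using fg(1,2) by (auto simp: det2_def int_lattice_def)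
  then have uv: "u \<in> int_lattice" "v \<in> int_lattice"
    using fg(1,2) unfolding u_def v_def int_lattice_def by (auto simp: forall_2)
  have "m \<in> int_lattice" using m(1) uv by (auto simp: int_lattice_def)
  moreover have "det2 u v = det2 f g ^ 2 * det2 f g"
    by (simp add: u_def v_def det2_def power2_eq_square algebra_simps)
  then have "det2 u v \<noteq> 0" using fg(3) by auto
  then have "m \<noteq> 0" using m(1) by (auto simp: det2_def vec_eq_iff forall_2 add_eq_0_iff)
  moreover have "det2 f g \<noteq> 0" using fg(3) by auto
  ultimately show ?thesis using that M fg(1,2) le_f le_g m(2) by blast
qed


section \<open>Successive minima\<close>

text \<open>
  The dimension of a set is defined in every real vector space, but sets without a finite basis
  get dimension \<open>0\<close>, so monotonicity needs a finite spanning set. The dual plane is a space of bounded functionals, for which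
  such a set has to be named explicitly.
\<close>

lemma dim_mono_of_finite_span:
  fixes S T B :: "'a::real_vector set"
  assumes "S \<subseteq> T" "T \<subseteq> span B" "finite B"
  shows "dim S \<le> dim T"
proof -
  obtain C where C: "C \<subseteq> T" "independent C" "T \<subseteq> span C" "card C = dim T"
    using basis_exists .
  have "finite C" using independent_span_bound[OF assms(3) C(2)] C(1) assms(2) by blast
  then show ?thesis using dim_le_card[of S C] C assms(1) by auto
qed

lemma diff_dim_mono:
  fixes S T B :: "'a::real_vector set"
  assumes "S \<subseteq> T" "span B = UNIV" "finite B"
  shows "diff_dim S \<le> diff_dim T"
  unfolding diff_dim_def
proof (rule dim_mono_of_finite_span[where B = B])
  show "span {a - b | a b. a \<in> S \<and> b \<in> S} \<subseteq> span {a - b | a b. a \<in> T \<and> b \<in> T}"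
    using assms(1) by (intro span_mono) auto
qed (use assms in auto)

lemma card_le_diff_dim:
  fixes B C S :: "'a::real_vector set"
  assumes "independent C" "C \<subseteq> S" "0 \<in> S" "span B = UNIV" "finite B"
  shows "card C \<le> diff_dim S"
proof -
  have "C \<subseteq> {a - b | a b. a \<in> S \<and> b \<in> S}"
  proof
    fix c assume "c \<in> C"
    then have "c = c - 0 \<and> c \<in> S \<and> 0 \<in> S" using assms by auto
    then show "c \<in> {a - b | a b. a \<in> S \<and> b \<in> S}" by blast
  qed
  then have "C \<subseteq> span {a - b | a b. a \<in> S \<and> b \<in> S}" by (meson span_superset order_trans)
  then have "dim C \<le> diff_dim S"
    unfolding diff_dim_def using assms by (intro dim_mono_of_finite_span[where B = B]) auto
  then show ?thesis using assms(1) by (simp add: dim_eq_card_independent)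
qed

lemma diff_dim_le_card:
  fixes S :: "'a::real_vector set"
  assumes "S \<subseteq> span C" "finite C"
  shows "diff_dim S \<le> card C"
proof -
  have "{a - b | a b. a \<in> S \<and> b \<in> S} \<subseteq> span C" using assms(1) by (auto intro: span_diff)
  then have "span {a - b | a b. a \<in> S \<and> b \<in> S} \<subseteq> span C" by (simp add: span_minimal)
  then show ?thesis unfolding diff_dim_def by (rule dim_le_card) fact
qed

lemma dilate_mono:
  fixes K :: "'a::real_vector set"
  assumes "convex K" "0 \<in> K" "0 \<le> s" "s \<le> t"
  shows "(\<lambda>x. s *\<^sub>R x) ` K \<subseteq> (\<lambda>x. t *\<^sub>R x) ` K"
proof (cases "t = 0")
  case True
  then show ?thesis using assms by auto
next
  case False
  show ?thesis
  proof
    fix y assume "y \<in> (\<lambda>x. s *\<^sub>R x) ` K"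
    then obtain x where x: "x \<in> K" "y = s *\<^sub>R x" by auto
    have "(s/t) *\<^sub>R x + (1 - s/t) *\<^sub>R 0 \<in> K"
      using assms x False by (intro convexD) (auto simp: field_simps)
    then have "(s/t) *\<^sub>R x \<in> K" by simp
    moreover have "y = t *\<^sub>R ((s/t) *\<^sub>R x)" using x False by simp
    ultimately show "y \<in> (\<lambda>x. t *\<^sub>R x) ` K" by (rule rev_image_eqI)
  qed
qed

text \<open>
  The dilates of a convex set containing the origin increase, so once the lattice points in one
  dilate have dimension at least \<open>i\<close>, all parameters of the supremum are below.
\<close>

lemma successive_minimum_le:
  fixes B K L :: "'a::real_vector set"
  assumes "convex K" "0 \<in> K" "span B = UNIV" "finite B"
    and "c \<ge> 0" "i \<le> diff_dim (L \<inter> (\<lambda>x. c *\<^sub>R x) ` K)"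
  shows "successive_minimum i L K \<le> ereal c"
  unfolding successive_minimum_def
proof (rule Sup_least, clarsimp)
  fix t :: real assume t: "0 \<le> t" "diff_dim (L \<inter> (\<lambda>x. t *\<^sub>R x) ` K) < i"
  show "t \<le> c"
  proof (rule ccontr)
    assume "\<not> t \<le> c"
    then have "L \<inter> (\<lambda>x. c *\<^sub>R x) ` K \<subseteq> L \<inter> (\<lambda>x. t *\<^sub>R x) ` K"
      using dilate_mono[OF assms(1,2,5), of t] by auto
    from diff_dim_mono[OF this assms(3,4)] show False using t assms(6) by linarith
  qed
qed

lemma le_diff_dim_of_successive_minimum_less:
  fixes K L :: "'a::real_vector set"
  assumes "successive_minimum i L K < ereal t" "t \<ge> 0"
  shows "i \<le> diff_dim (L \<inter> (\<lambda>x. t *\<^sub>R x) ` K)"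
proof (rule ccontr)
  assume "\<not> ?thesis"
  then have "ereal t \<le> successive_minimum i L K"
    unfolding successive_minimum_def using assms(2) by (intro Sup_upper) auto
  then show False using assms(1) by simp
qed

lemma successive_minimum_nonneg:
  fixes K L :: "'a::real_vector set"
  assumes "i \<ge> 1"
  shows "successive_minimum i L K \<ge> 0"
proof -
  have "diff_dim (L \<inter> (\<lambda>x. 0 *\<^sub>R x) ` K) \<le> card ({} :: 'a set)"
    by (rule diff_dim_le_card) auto
  then have "ereal 0 \<le> successive_minimum i L K"
    unfolding successive_minimum_def using assms by (intro Sup_upper) auto
  then show ?thesis by (simp add: zero_ereal_def)
qed

section \<open>The dual plane\<close>

lemma functional_eq_inner:
  fixes \<phi> :: "(real ^ 2) \<Rightarrow>\<^sub>L real"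
  shows "\<phi> = blinfun_inner_right (\<chi> i. \<phi> (axis i 1))"
proof (rule blinfun_eqI)
  fix x :: "real ^ 2"
  have "x = x $ 1 *\<^sub>R axis 1 1 + x $ 2 *\<^sub>R axis 2 1"
    by (simp add: vec_eq_iff forall_2 axis_def)
  then have "\<phi> x = \<phi> (x $ 1 *\<^sub>R axis 1 1 + x $ 2 *\<^sub>R axis 2 1)" by simp
  also have "\<dots> = x $ 1 * \<phi> (axis 1 1) + x $ 2 * \<phi> (axis 2 1)"
    by (simp add: blinfun.add_right blinfun.scaleR_right)
  finally show "\<phi> x = blinfun_inner_right (\<chi> i. \<phi> (axis i 1)) x"
    by (simp add: inner_vec_def sum_2 mult.commute)
qed

lemma dual_plane_spanned:
  "span {blinfun_inner_right (axis 1 1), blinfun_inner_right (axis 2 1)}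
    = (UNIV :: ((real ^ 2) \<Rightarrow>\<^sub>L real) set)"
proof -
  have "\<phi> \<in> span {blinfun_inner_right (axis 1 1), blinfun_inner_right (axis 2 1)}"
    for \<phi> :: "(real ^ 2) \<Rightarrow>\<^sub>L real"
  proof -
    have "\<phi> = \<phi> (axis 1 1) *\<^sub>R blinfun_inner_right (axis 1 1)
        + \<phi> (axis 2 1) *\<^sub>R blinfun_inner_right (axis 2 1)"
      by (subst functional_eq_inner, rule blinfun_eqI)
        (simp add: blinfun.add_left blinfun.scaleR_left inner_vec_def sum_2 axis_def)
    then show ?thesis by (metis span_add span_scale span_base insertI1 insertI2)
  qed
  then show ?thesis by auto
qed

lemma annihilator_one_dimensional:
  fixes \<phi> :: "(real ^ 2) \<Rightarrow>\<^sub>L real" and m :: "real ^ 2"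
  assumes "m \<noteq> 0" "\<phi> m = 0"
  shows "\<phi> \<in> span {blinfun_inner_right (vector [- m $ 2, m $ 1])}"
proof -
  let ?\<omega> = "blinfun_inner_right (vector [- m $ 2, m $ 1] :: real ^ 2)"
  define w where "w = (\<chi> i. \<phi> (axis i 1))"
  have \<phi>: "\<phi> = blinfun_inner_right w" unfolding w_def by (rule functional_eq_inner)
  have ann: "w $ 1 * m $ 1 + w $ 2 * m $ 2 = 0"
    using assms(2) by (subst (asm) \<phi>) (simp add: inner_vec_def sum_2)
  have "\<exists>c. w = c *\<^sub>R vector [- m $ 2, m $ 1]"
  proof (cases "m $ 1 = 0")
    case True
    then have "m $ 2 \<noteq> 0" using assms(1) by (auto simp: vec_eq_iff forall_2)
    then show ?thesis using True ann
      by (intro exI[of _ "- w $ 1 / m $ 2"]) (simp add: vec_eq_iff forall_2)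
  next
    case False
    then show ?thesis using ann
      by (intro exI[of _ "w $ 2 / m $ 1"]) (simp add: vec_eq_iff forall_2 field_simps add_eq_0_iff)
  qed
  then obtain c where "w = c *\<^sub>R vector [- m $ 2, m $ 1]" by blast
  then have "\<phi> = c *\<^sub>R ?\<omega>" unfolding \<phi> by (intro blinfun_eqI) (simp add: blinfun.scaleR_left)
  then show ?thesis by (simp add: span_base span_scale)
qed

lemma independent_inner_functionals:
  fixes f g :: "real ^ 2"
  assumes "det2 f g \<noteq> 0"
  shows "independent {blinfun_inner_right f, blinfun_inner_right g}"
    and "card {blinfun_inner_right f, blinfun_inner_right g} = 2"
proof -
  have eq: "a = 0 \<and> b = 0" if "a *\<^sub>R blinfun_inner_right f + b *\<^sub>R blinfun_inner_right g = 0" for a b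
  proof -
    have "(a *\<^sub>R blinfun_inner_right f + b *\<^sub>R blinfun_inner_right g) (axis i 1) = 0" for i
      using that by simp
    then have *: "a * f $ i + b * g $ i = 0" for i
      by (simp add: blinfun.add_left blinfun.scaleR_left inner_axis)
    have "a * det2 f g = (a * f $ 1 + b * g $ 1) * g $ 2 - (a * f $ 2 + b * g $ 2) * g $ 1"
      "b * det2 f g = (a * f $ 2 + b * g $ 2) * f $ 1 - (a * f $ 1 + b * g $ 1) * f $ 2"
      by (simp_all add: det2_def algebra_simps)
    then have "a * det2 f g = 0" "b * det2 f g = 0" unfolding * by simp_all
    then show ?thesis using assms by simp
  qed
  have ne: "blinfun_inner_right f \<noteq> blinfun_inner_right g"
    using eq[of 1 "- 1"] by auto
  then show "card {blinfun_inner_right f, blinfun_inner_right g} = 2" by simp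
  have "blinfun_inner_right g \<noteq> 0" using eq[of 0 1] by auto
  moreover have "blinfun_inner_right f \<notin> span {blinfun_inner_right g}"
  proof
    assume "blinfun_inner_right f \<in> span {blinfun_inner_right g}"
    then obtain k where "blinfun_inner_right f = k *\<^sub>R blinfun_inner_right g"
      by (auto simp: span_singleton)
    then show False using eq[of 1 "- k"] by simp
  qed
  ultimately show "independent {blinfun_inner_right f, blinfun_inner_right g}"
    using ne by (simp add: independent_insert)
qed

lemma convex_polar_body: "convex (polar_body K)"
proof (rule convexI)
  fix \<phi> \<psi> and a b :: real
  assume *: "\<phi> \<in> polar_body K" "\<psi> \<in> polar_body K" "0 \<le> a" "0 \<le> b" "a + b = 1"
  have "a * \<phi> m + b * \<psi> m \<ge> - 1" if "m \<in> K" for m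
  proof -
    have "a * \<phi> m \<ge> a * - 1" "b * \<psi> m \<ge> b * - 1"
      using * that unfolding polar_body_def by (blast intro: mult_left_mono)+
    then show ?thesis using *(5) by simp
  qed
  then show "a *\<^sub>R \<phi> + b *\<^sub>R \<psi> \<in> polar_body K"
    by (simp add: polar_body_def blinfun.add_left blinfun.scaleR_left)
qed

lemma zero_in_polar_body: "0 \<in> polar_body K"
  by (simp add: polar_body_def)

lemma inner_in_dual_lattice:
  fixes f :: "real ^ 'n"
  assumes "f \<in> int_lattice"
  shows "blinfun_inner_right f \<in> dual_lattice int_lattice"
  using assms unfolding dual_lattice_def int_lattice_def
  by (auto simp: inner_vec_def intro!: Ints_sum Ints_mult)

lemma inner_in_dilated_polar_body:
  fixes K :: "'a::real_inner set"
  assumes "zero_symmetric K" "M > 0" "\<And>x. x \<in> K \<Longrightarrow> f \<bullet> x \<le> M"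
  shows "blinfun_inner_right f \<in> (\<lambda>\<phi>. M *\<^sub>R \<phi>) ` polar_body K"
proof -
  have "f \<bullet> x \<ge> - M" if "x \<in> K" for x
    using assms(3)[OF symmetric_mem_uminus[OF assms(1) that]] by simp
  then have "(1/M) *\<^sub>R blinfun_inner_right f \<in> polar_body K"
    using assms(2) by (auto simp: polar_body_def blinfun.scaleR_left field_simps)
  moreover have "blinfun_inner_right f = M *\<^sub>R ((1/M) *\<^sub>R blinfun_inner_right f)"
    using assms(2) by simp
  ultimately show ?thesis by (metis image_eqI)
qed

text \<open>
  Functionals vanishing at a nonzero vector of the plane form a line, so a set of functionals of
  dimension two contains one that does not vanish there; its value at a lattice vector is an
  integer, hence at least one in absolute value.
\<close>

lemma pairing_bound:
  fixes K :: "(real ^ 2) set"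
  assumes sym: "zero_symmetric K" and st: "s \<ge> 0" "t \<ge> 0"
    and d1: "1 \<le> diff_dim (int_lattice \<inter> (\<lambda>x. s *\<^sub>R x) ` K)"
    and d2: "2 \<le> diff_dim (dual_lattice int_lattice \<inter> (\<lambda>x. t *\<^sub>R x) ` polar_body K)"
  shows "1 \<le> s * t"
proof -
  have "\<not> int_lattice \<inter> (\<lambda>x. s *\<^sub>R x) ` K \<subseteq> span {}"
    using diff_dim_le_card[of _ "{} :: (real ^ 2) set"] d1 by fastforce
  then obtain k where k: "k \<in> K" "s *\<^sub>R k \<in> int_lattice" "s *\<^sub>R k \<noteq> 0"
    unfolding span_empty by blast
  let ?m = "s *\<^sub>R k"
  have "\<not> dual_lattice int_lattice \<inter> (\<lambda>x. t *\<^sub>R x) ` polar_body K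
      \<subseteq> span {blinfun_inner_right (vector [- ?m $ 2, ?m $ 1])}" (is "\<not> ?S \<subseteq> span {?\<omega>}")
  proof
    assume "?S \<subseteq> span {?\<omega>}"
    then have "diff_dim ?S \<le> card {?\<omega>}" by (rule diff_dim_le_card) simp
    then show False using d2 by simp
  qed
  then obtain \<psi> where \<psi>: "\<psi> \<in> polar_body K" "t *\<^sub>R \<psi> \<in> dual_lattice int_lattice"
    "(t *\<^sub>R \<psi>) ?m \<noteq> 0"
    using annihilator_one_dimensional[OF k(3)] by blast
  have "(t *\<^sub>R \<psi>) ?m \<in> \<int>" using \<psi>(2) k(2) by (simp add: dual_lattice_def)
  then have "1 \<le> \<bar>(t *\<^sub>R \<psi>) ?m\<bar>" using \<psi>(3) by (rule Ints_nonzero_abs_ge1)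
  also have "\<dots> = s * t * \<bar>\<psi> k\<bar>"
    using st by (simp add: blinfun.scaleR_left blinfun.scaleR_right abs_mult)
  also have "\<dots> \<le> s * t * 1"
  proof (intro mult_left_mono)
    have "\<psi> k \<ge> - 1" "\<psi> (- k) \<ge> - 1"
      using \<psi>(1) k(1) symmetric_mem_uminus[OF sym k(1)] by (auto simp: polar_body_def)
    then show "\<bar>\<psi> k\<bar> \<le> 1" by (simp add: blinfun.minus_right abs_le_iff)
  qed (use st in simp)
  finally show ?thesis by simp
qed

theorem theorem6p4:
  fixes K :: "(real ^ 2) set"
  assumes "convex_body K" and "zero_symmetric K"
  shows "1 \<le> successive_minimum 1 int_lattice K
              * successive_minimum 2 (dual_lattice int_lattice) (polar_body K)
       \<and> successive_minimum 1 int_lattice K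
              * successive_minimum 2 (dual_lattice int_lattice) (polar_body K) \<le> ereal (3 / 2)"
proof -
  let ?L = "int_lattice :: (real ^ 2) set"
  let ?D = "dual_lattice ?L" and ?P = "polar_body K"
  let ?a = "successive_minimum 1 ?L K" and ?b = "successive_minimum 2 ?D ?P"
  obtain M f g m where M: "M > 0"
    and fg: "f \<in> ?L" "g \<in> ?L" "det2 f g \<noteq> 0"
      "\<And>x. x \<in> K \<Longrightarrow> f \<bullet> x \<le> M" "\<And>x. x \<in> K \<Longrightarrow> g \<bullet> x \<le> M"
    and m: "m \<in> ?L" "m \<noteq> 0" "m \<in> (\<lambda>x. (3 / (2 * M)) *\<^sub>R x) ` K"
    using reduced_pair_with_short_lattice_vector[OF assms] by metis
  have K: "convex K" using assms(1) by (simp add: convex_body_def)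
  have zK: "0 \<in> K"
    using symmetric_body_contains_ball[OF assms] by (metis centre_in_cball less_imp_le subsetD)
  have a_le: "?a \<le> ereal (3 / (2 * M))"
  proof (rule successive_minimum_le[OF K zK span_Basis finite_Basis])
    have "card {m} \<le> diff_dim (?L \<inter> (\<lambda>x. (3 / (2 * M)) *\<^sub>R x) ` K)"
    proof (rule card_le_diff_dim[where B = Basis])
      show "0 \<in> ?L \<inter> (\<lambda>x. (3 / (2 * M)) *\<^sub>R x) ` K"
        using zK by (auto simp: int_lattice_def image_iff intro!: bexI[of _ 0])
    qed (use m in \<open>auto simp: span_Basis\<close>)
    then show "1 \<le> diff_dim (?L \<inter> (\<lambda>x. (3 / (2 * M)) *\<^sub>R x) ` K)" by simp
  qed (use M in auto)
  have b_le: "?b \<le> ereal M"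
  proof (rule successive_minimum_le[OF convex_polar_body zero_in_polar_body dual_plane_spanned])
    have "card {blinfun_inner_right f, blinfun_inner_right g} \<le> diff_dim (?D \<inter> (\<lambda>x. M *\<^sub>R x) ` ?P)"
    proof (rule card_le_diff_dim[OF independent_inner_functionals(1)[OF fg(3)] _ _ dual_plane_spanned])
      show "{blinfun_inner_right f, blinfun_inner_right g} \<subseteq> ?D \<inter> (\<lambda>x. M *\<^sub>R x) ` ?P"
        using inner_in_dual_lattice fg inner_in_dilated_polar_body[OF assms(2) M] by auto
      show "0 \<in> ?D \<inter> (\<lambda>x. M *\<^sub>R x) ` ?P"
        using zero_in_polar_body by (auto simp: dual_lattice_def image_iff intro!: bexI[of _ 0])
    qed auto
    then show "2 \<le> diff_dim (?D \<inter> (\<lambda>x. M *\<^sub>R x) ` ?P)"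
      using independent_inner_functionals(2)[OF fg(3)] by simp
  qed (use M in auto)
  have nonneg: "?a \<ge> 0" "?b \<ge> 0" by (rule successive_minimum_nonneg; simp)+
  obtain a where a: "?a = ereal a" "a \<ge> 0" using a_le nonneg by (cases ?a) auto
  obtain b where b: "?b = ereal b" "b \<ge> 0" using b_le nonneg by (cases ?b) auto
  have "a * b \<le> 3 / (2 * M) * M"
    using a b a_le b_le M by (intro mult_mono) auto
  then have upper: "a * b \<le> 3 / 2" using M by simp
  \<comment> \<open>The pairing bound needs dilates strictly beyond the suprema, hence the limit \<open>\<epsilon> \<rightarrow> 0\<close>.\<close>
  have "1 \<le> (a + \<epsilon>) * (b + \<epsilon>)" if "\<epsilon> > 0" for \<epsilon>
    using that a b
    by (intro pairing_bound[OF assms(2)] le_diff_dim_of_successive_minimum_less) auto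
  then have "\<forall>\<^sub>F \<epsilon> in at_right 0. 1 \<le> (a + \<epsilon>) * (b + \<epsilon>)"
    by (auto simp: eventually_at_right_field intro: exI[of _ 1])
  moreover have "((\<lambda>\<epsilon>. (a + \<epsilon>) * (b + \<epsilon>)) \<longlongrightarrow> (a + 0) * (b + 0)) (at_right 0)"
    by (intro tendsto_intros)
  ultimately have "1 \<le> (a + 0) * (b + 0)"
    by (intro tendsto_lowerbound[where F = "at_right 0"]) auto
  then show ?thesis using upper a b by (simp add: one_ereal_def)
qed

end
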